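(* Let $X$ be a compact metrizable space and $d$ a metric on $X$ compatible with its topology. For a nonempty closed subset $K\subseteq X$ let $\mathcal{F}_K:=\{\mu\in\mathcal{S}C(X):\operatorname{supp}(\mu)\subseteq K\}$. Then $K\mapsto\mathcal{F}_K$ is an isometric embedding from $(\mathfrak{S}_{\mathrm{cl}}X,\mathcal{H}_d)$ into $(\mathfrak{S}_{\mathrm{cl}}\,\mathcal{S}C(X),\mathcal{H}_{\rho_d})$; that is, $\mathcal{H}_{\rho_d}(\mathcal{F}_K,\mathcal{F}_{K'})=\mathcal{H}_d(K,K')$ for all nonempty closed $K,K'\subseteq X$.
   Context: $C(X)$ is the C*-algebra of complex-valued continuous functions on $X$, and $C(X)_{\mathrm{sa}}$ its self-adjoint part (the real-valued continuous functions). $\mathcal{S}C(X)$ is the state space of $C(X)$ with the weak* topology, identified with the space of regular Borel probability measures on $X$; $\mu(f)=\int f\,d\mu$. For a compact Hausdorff space $Y$, $\mathfrak{S}_{\mathrm{cl}}Y$ is the set of nonempty closed subsets of $Y$. If $\rho$ is a metric compatible with the topology of $Y$, the Hausdorff distance on $\mathfrak{S}_{\mathrm{cl}}Y$ is $$\mathcal{H}_\rho(K,K')=\inf\{r>0:K\subseteq\mathrm{Ball}(K',r),\ K'\subseteq\mathrm{Ball}(K,r)\},$$ where $\mathrm{Ball}(K,r)=\{y\in Y:\rho(x,y)<r\text{ for some }x\in K\}$. The Lipschitz seminorm is $\mathcal{L}_d(f):=\sup\{|f(x)-f(y)|/d(x,y):x,y\in X,\ x\neq y\}\in[0,\infty]$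 for $f\in C(X)_{\mathrm{sa}}$, and the Monge–Kantorovich distance on $\mathcal{S}C(X)$ is $$\rho_d(\mu,\nu):=\sup\{|\mu(f)-\nu(f)|:f\in C(X)_{\mathrm{sa}},\ \mathcal{L}_d(f)\leq1\}.$$ It is a metric inducing the weak* topology. *)

theory Defs
  imports "HOL-Probability.Probability"
begin

text \<open>
  The compact space \<open>X\<close> is a type \<open>'a\<close> with \<open>compact UNIV\<close>, and \<open>d\<close> is an explicit function.  The
  Hausdorff distance is also used on a set of measures, so it takes the ambient carrier \<open>Y\<close>
  as a parameter.
\<close>

definition compatible_metric :: "('a::topological_space \<Rightarrow> 'a \<Rightarrow> real) \<Rightarrow> bool" where
  "compatible_metric d \<longleftrightarrow> Metric_space UNIV d \<and> Metric_space.mtopology UNIV d = euclidean"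

definition closed_subsets :: "'a topology \<Rightarrow> 'a set set" where
  "closed_subsets T = {K. closedin T K \<and> K \<noteq> {}}"

definition Ball_on :: "'a set \<Rightarrow> ('a \<Rightarrow> 'a \<Rightarrow> real) \<Rightarrow> 'a set \<Rightarrow> real \<Rightarrow> 'a set" where
  "Ball_on Y \<rho> K r = {y \<in> Y. \<exists>x\<in>K. \<rho> x y < r}"

definition hausdorff_dist ::
  "'a set \<Rightarrow> ('a \<Rightarrow> 'a \<Rightarrow> real) \<Rightarrow> 'a set \<Rightarrow> 'a set \<Rightarrow> real" where
  "hausdorff_dist Y \<rho> K K' =
     Inf {r. r > 0 \<and> K \<subseteq> Ball_on Y \<rho> K' r \<and> K' \<subseteq> Ball_on Y \<rho> K r}"

definition C_complex :: "('a::topological_space \<Rightarrow> complex) set" where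
  "C_complex = {f. continuous_on UNIV f}"

definition C_sa :: "('a::topological_space \<Rightarrow> real) set" where
  "C_sa = {f. continuous_on UNIV f}"

definition regular_borel :: "'a::topological_space measure \<Rightarrow> bool" where
  "regular_borel \<mu> \<longleftrightarrow> sets \<mu> = sets borel \<and>
     (\<forall>B\<in>sets borel.
        emeasure \<mu> B = (SUP C\<in>{C. compact C \<and> C \<subseteq> B}. emeasure \<mu> C) \<and>
        emeasure \<mu> B = (INF U\<in>{U. open U \<and> B \<subseteq> U}. emeasure \<mu> U))"

definition states :: "'a::topological_space measure set" where
  "states = {\<mu>. prob_space \<mu> \<and> regular_borel \<mu>}"

text \<open>
  The weak* topology: the coarsest topology making \<open>\<mu> \<mapsto> \<integral>f d\<mu>\<close> continuous for every continuous
  complex-valued \<open>f\<close>, i.e. the one pulled back from the product topology.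
\<close>

definition weak_star :: "'a::topological_space measure topology" where
  "weak_star = pullback_topology states
     (\<lambda>\<mu>. \<lambda>f\<in>C_complex. integral\<^sup>L \<mu> f)
     (product_topology (\<lambda>_. euclidean) C_complex)"

definition measure_supp :: "'a::topological_space measure \<Rightarrow> 'a set" where
  "measure_supp \<mu> = {x. \<forall>U. open U \<and> x \<in> U \<longrightarrow> emeasure \<mu> U > 0}"

text \<open>The supremum is taken in \<open>ennreal\<close>, so it is \<open>0\<close> on a one-point space.\<close>

definition lipschitz_seminorm :: "('a \<Rightarrow> 'a \<Rightarrow> real) \<Rightarrow> ('a \<Rightarrow> real) \<Rightarrow> ennreal" where
  "lipschitz_seminorm d f = (SUP (x, y)\<in>{(x, y). x \<noteq> y}. ennreal (\<bar>f x - f y\<bar> / d x y))"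

text \<open>
  The supremum is taken in \<open>real\<close>.  For a metric compatible with a compact topology, the set is
  nonempty and bounded by the diameter of the space.
\<close>

definition monge_kantorovich ::
  "('a::topological_space \<Rightarrow> 'a \<Rightarrow> real) \<Rightarrow> 'a measure \<Rightarrow> 'a measure \<Rightarrow> real" where
  "monge_kantorovich d \<mu> \<nu> =
     Sup {\<bar>integral\<^sup>L \<mu> f - integral\<^sup>L \<nu> f\<bar> |f. f \<in> C_sa \<and> lipschitz_seminorm d f \<le> 1}"

definition face :: "'a::topological_space set \<Rightarrow> 'a measure set" where
  "face K = {\<mu> \<in> states. measure_supp \<mu> \<subseteq> K}"

end

theory Submission
  imports Defs
begin

text \<open>
  A state is supported in the nonempty closed set \<open>K\<close> exactly when it annihilates the function
  \<open>x \<mapsto> dist(x, K)\<close>.  This one function serves twice.  Being continuous, it exhibits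
  \<open>face K\<close> as the zero set of a weak* continuous functional, so \<open>face K\<close> is weak* closed.  Being \<open>1\<close>-Lipschitz, it is a test function for the Monge--Kantorovich distance; it has integral
  \<open>0\<close> against every state on \<open>K'\<close> and value \<open>dist(x, K')\<close> at the Dirac state of \<open>x\<close>, so
  a Dirac state within \<open>r\<close> of \<open>face K'\<close> sits at a point within \<open>r\<close> of \<open>K'\<close>.  Thus distances
  between faces are at least distances between sets.

  For the other inequality, mass is transported.  If \<open>K\<close> lies in the \<open>r\<close>-neighbourhood of \<open>K'\<close>,
  compactness of \<open>K\<close> gives a Borel map \<open>T\<close> with finitely many values, all in \<open>K'\<close>, that moves each
  point of \<open>K\<close> by less than \<open>r\<close>.  The image under \<open>T\<close> of a state on \<open>K\<close> is a state on \<open>K'\<close>, and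
  integrating \<open>\<bar>f x - f (T x)\<bar> \<le> d x (T x)\<close> shows that it is at distance at most \<open>r\<close>.  Finitely many
  values are enough, and they make the regularity of the image measure evident.

  Injectivity follows because the Dirac state at \<open>x\<close> belongs to \<open>face K\<close> only if \<open>x\<close> is in \<open>K\<close>.
\<close>

section \<open>States and their supports\<close>

lemma
  assumes "\<mu> \<in> states"
  shows states_prob_space: "prob_space \<mu>"
    and states_sets: "sets \<mu> = sets borel"
    and states_space: "space \<mu> = UNIV"
  using assms sets_eq_imp_space_eq[of \<mu> borel] by (auto simp: states_def regular_borel_def)

lemma states_inner_regular:
  assumes "\<mu> \<in> states" "B \<in> sets borel"
  shows "emeasure \<mu> B = (SUP C\<in>{C. compact C \<and> C \<subseteq> B}. emeasure \<mu> C)"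
proof -
  have "regular_borel \<mu>" using assms(1) by (simp add: states_def)
  then show ?thesis
    unfolding regular_borel_def using assms(2) by (elim conjE) (drule (1) bspec, elim conjE)
qed

text \<open>
  Inner regularity replaces second countability here: a compact set that misses the support is
  covered by finitely many open null sets.
\<close>

lemma emeasure_open_disjoint_supp:
  fixes \<mu> :: "'a::t2_space measure"
  assumes \<mu>: "\<mu> \<in> states" and U: "open U" "U \<inter> measure_supp \<mu> = {}"
  shows "emeasure \<mu> U = 0"
proof -
  have sets: "sets \<mu> = sets borel" using \<mu> by (rule states_sets)
  have "emeasure \<mu> C = 0" if C: "compact C" "C \<subseteq> U" for C
  proof -
    have "\<exists>V. open V \<and> x \<in> V \<and> emeasure \<mu> V = 0" if "x \<in> C" for x
    proof -
      have "x \<notin> measure_supp \<mu>" using that C U by auto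
      then show ?thesis unfolding measure_supp_def by (auto simp: not_less)
    qed
    then obtain V where V: "\<And>x. x \<in> C \<Longrightarrow> open (V x) \<and> x \<in> V x \<and> emeasure \<mu> (V x) = 0"
      by metis
    obtain F where F: "F \<subseteq> C" "finite F" "C \<subseteq> (\<Union>x\<in>F. V x)"
      using compactE_image[OF C(1), of C V] V by blast
    have null: "(\<Union>x\<in>F. V x) \<in> null_sets \<mu>"
      using F V sets by (intro null_sets.finite_UN null_setsI) auto
    have "C \<in> sets \<mu>" using C sets by (simp add: borel_compact)
    with null F show ?thesis by (meson null_sets_subset null_setsD1)
  qed
  then have "(SUP C\<in>{C. compact C \<and> C \<subseteq> U}. emeasure \<mu> C) \<le> 0"
    by (intro SUP_least) auto
  moreover have "emeasure \<mu> U = (SUP C\<in>{C. compact C \<and> C \<subseteq> U}. emeasure \<mu> C)"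
    using U(1) by (intro states_inner_regular[OF \<mu>]) simp
  ultimately show ?thesis by simp
qed

lemma measure_supp_subset_iff:
  fixes \<mu> :: "'a::t2_space measure"
  assumes \<mu>: "\<mu> \<in> states" and K: "closed K"
  shows "measure_supp \<mu> \<subseteq> K \<longleftrightarrow> (AE x in \<mu>. x \<in> K)"
proof -
  have sets: "- K \<in> sets \<mu>" using states_sets[OF \<mu>] K by auto
  have "measure_supp \<mu> \<subseteq> K \<longleftrightarrow> emeasure \<mu> (- K) = 0"
  proof
    show "emeasure \<mu> (- K) = 0" if "measure_supp \<mu> \<subseteq> K"
      using that K by (intro emeasure_open_disjoint_supp[OF \<mu>]) auto
  next
    assume 0: "emeasure \<mu> (- K) = 0"
    show "measure_supp \<mu> \<subseteq> K"
    proof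
      fix x assume "x \<in> measure_supp \<mu>"
      then have "x \<in> - K \<Longrightarrow> emeasure \<mu> (- K) > 0"
        using K unfolding measure_supp_def by (auto simp: open_Compl)
      with 0 show "x \<in> K" by auto
    qed
  qed
  also have "\<dots> \<longleftrightarrow> (AE x in \<mu>. x \<in> K)"
    by (subst AE_iff_measurable[OF sets]) (auto simp: states_space[OF \<mu>])
  finally show ?thesis .
qed

lemma face_iff_AE:
  fixes \<mu> :: "'a::t2_space measure"
  assumes "closed K"
  shows "\<mu> \<in> face K \<longleftrightarrow> \<mu> \<in> states \<and> (AE x in \<mu>. x \<in> K)"
  using measure_supp_subset_iff[OF _ assms] by (auto simp: face_def)

text \<open>
  On a finite set \<open>F\<close> of full measure, inner and outer approximation are exact: the compact set
  \<open>B \<inter> F\<close> and the open set \<open>- (F - B)\<close> have the same measure as \<open>B\<close>.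
\<close>

lemma finitely_supported_in_states:
  fixes \<mu> :: "'a::t2_space measure"
  assumes "prob_space \<mu>" and sets: "sets \<mu> = sets borel"
    and F: "finite F" "AE x in \<mu>. x \<in> F"
  shows "\<mu> \<in> states"
proof -
  have fin: "G \<in> sets \<mu>" if "finite G" for G
    using that sets by (simp add: finite_imp_closed)
  have reg: "emeasure \<mu> B = (SUP C\<in>{C. compact C \<and> C \<subseteq> B}. emeasure \<mu> C) \<and>
        emeasure \<mu> B = (INF U\<in>{U. open U \<and> B \<subseteq> U}. emeasure \<mu> U)"
    if B: "B \<in> sets borel" for B
  proof
    have B': "B \<in> sets \<mu>" using B sets by simp
    have "emeasure \<mu> (B \<inter> F) = emeasure \<mu> B"
      using F B' fin[of F] by (intro emeasure_eq_AE) auto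
    moreover have "compact (B \<inter> F)" using F by (auto intro: finite_imp_compact)
    ultimately have "emeasure \<mu> B \<le> (SUP C\<in>{C. compact C \<and> C \<subseteq> B}. emeasure \<mu> C)"
      by (intro SUP_upper2[of "B \<inter> F"]) auto
    moreover have "(SUP C\<in>{C. compact C \<and> C \<subseteq> B}. emeasure \<mu> C) \<le> emeasure \<mu> B"
      using B' by (intro SUP_least emeasure_mono) auto
    ultimately show "emeasure \<mu> B = (SUP C\<in>{C. compact C \<and> C \<subseteq> B}. emeasure \<mu> C)"
      by (rule antisym)
    have open_compl: "open (- (F - B))"
      using F by (intro open_Compl finite_imp_closed) auto
    have "emeasure \<mu> (- (F - B)) = emeasure \<mu> B"
      using F B' open_compl sets by (intro emeasure_eq_AE) auto
    with open_compl have "(INF U\<in>{U. open U \<and> B \<subseteq> U}. emeasure \<mu> U) \<le> emeasure \<mu> B"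
      by (intro INF_lower2[of "- (F - B)"]) auto
    moreover have "emeasure \<mu> B \<le> (INF U\<in>{U. open U \<and> B \<subseteq> U}. emeasure \<mu> U)"
      using sets by (intro INF_greatest emeasure_mono) auto
    ultimately show "emeasure \<mu> B = (INF U\<in>{U. open U \<and> B \<subseteq> U}. emeasure \<mu> U)"
      by (intro antisym)
  qed
  show ?thesis
    unfolding states_def regular_borel_def
    by (intro CollectI conjI[OF assms(1)] conjI[OF sets] ballI reg)
qed

lemma dirac_in_face_iff:
  fixes x :: "'a::t2_space"
  assumes K: "closed K"
  shows "return borel x \<in> face K \<longleftrightarrow> x \<in> K"
proof -
  have AE: "(AE y in return borel x. y \<in> C) \<longleftrightarrow> x \<in> C" if "closed C" for C
    using that by (subst AE_return) (auto simp: pred_def)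
  have "return borel x \<in> states"
    using AE[of "{x}"] by (intro finitely_supported_in_states[of _ "{x}"] prob_space_return) auto
  with K show ?thesis by (simp add: face_iff_AE AE)
qed

lemma continuous_integrable_state:
  fixes f :: "'a::t2_space \<Rightarrow> real"
  assumes "compact (UNIV :: 'a set)" "continuous_on UNIV f" and \<mu>: "\<mu> \<in> states"
  shows "integrable \<mu> f"
proof -
  interpret prob_space \<mu> using \<mu> by (rule states_prob_space)
  have "bounded (range f)" using assms by (intro compact_imp_bounded compact_continuous_image)
  then obtain B where "\<And>x. norm (f x) \<le> B" by (auto simp: bounded_iff)
  moreover have "f \<in> borel_measurable \<mu>"
    using borel_measurable_continuous_onI[OF assms(2)]
    by (simp cong: measurable_cong_sets add: states_sets[OF \<mu>])
  ultimately show ?thesis by (intro integrable_const_bound[of _ B]) auto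
qed

section \<open>Lipschitz functions and the distance to a closed set\<close>

locale compact_metrized =
  fixes d :: "'a::t2_space \<Rightarrow> 'a \<Rightarrow> real"
  assumes compact_UNIV: "compact (UNIV :: 'a set)"
    and compatible: "compatible_metric d"
begin

sublocale Metric_space UNIV d
  using compatible by (simp add: compatible_metric_def)

lemma open_iff_ball: "open U \<longleftrightarrow> (\<forall>x\<in>U. \<exists>r>0. \<forall>y. d x y < r \<longrightarrow> y \<in> U)"
proof -
  have "open U \<longleftrightarrow> openin mtopology U"
    using compatible by (simp add: compatible_metric_def)
  then show ?thesis by (auto simp: openin_mtopology in_mball subset_iff)
qed

lemma lipschitz_imp_continuous:
  fixes f :: "'a \<Rightarrow> real"
  assumes "\<And>x y. \<bar>f x - f y\<bar> \<le> d x y"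
  shows "continuous_on UNIV f"
proof (subst continuous_on_open_vimage, simp, intro allI impI)
  fix B :: "real set" assume "open B"
  show "open (f -` B \<inter> UNIV)"
    unfolding open_iff_ball
  proof
    fix x assume "x \<in> f -` B \<inter> UNIV"
    with \<open>open B\<close> obtain e where "e > 0" "\<And>y. \<bar>y - f x\<bar> < e \<Longrightarrow> y \<in> B"
      by (auto simp: open_dist dist_real_def)
    moreover have "\<bar>f y - f x\<bar> \<le> d x y" for y
      using assms[of y x] commute by simp
    ultimately show "\<exists>r>0. \<forall>y. d x y < r \<longrightarrow> y \<in> f -` B \<inter> UNIV"
      by (intro exI[of _ e]) (auto intro: le_less_trans)
  qed
qed

lemma continuous_on_dist: "continuous_on UNIV (d p)"
proof (rule lipschitz_imp_continuous)
  show "\<bar>d p x - d p y\<bar> \<le> d x y" for x y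
    using triangle[of p x y] triangle[of p y x] commute[of x y] by auto
qed

lemma open_metric_ball: "open {x. d p x < r}"
  by (intro open_Collect_less continuous_on_dist continuous_on_const)

lemma dist_bounded:
  obtains D where "D > 0" "\<And>x y. d x y < D"
proof -
  fix p
  have "bounded (range (d p))"
    by (intro compact_imp_bounded compact_continuous_image continuous_on_dist compact_UNIV)
  then obtain B where B: "\<And>x. \<bar>d p x\<bar> \<le> B" by (auto simp: bounded_iff)
  show ?thesis
  proof (rule that[of "2 * B + 1"])
    show "d x y < 2 * B + 1" for x y
      using triangle[of x p y] B[of x] B[of y] commute[of x p] by auto
    show "2 * B + 1 > 0" using B[of p] by auto
  qed
qed

lemma lipschitz_seminorm_le_1_iff:
  "lipschitz_seminorm d f \<le> 1 \<longleftrightarrow> (\<forall>x y. \<bar>f x - f y\<bar> \<le> d x y)"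
proof -
  have "\<bar>f x - f y\<bar> / d x y \<le> 1 \<longleftrightarrow> \<bar>f x - f y\<bar> \<le> d x y" if "x \<noteq> y" for x y
    using that mdist_pos_less[of x y] by (simp add: field_simps)
  then have "lipschitz_seminorm d f \<le> 1 \<longleftrightarrow> (\<forall>x y. x \<noteq> y \<longrightarrow> \<bar>f x - f y\<bar> \<le> d x y)"
    unfolding lipschitz_seminorm_def by (auto simp: SUP_le_iff ennreal_le_1)
  moreover have "\<bar>f x - f x\<bar> \<le> d x x" for x by simp
  ultimately show ?thesis by metis
qed

lemma monge_kantorovich_alt:
  "monge_kantorovich d \<mu> \<nu> =
     Sup {\<bar>integral\<^sup>L \<mu> f - integral\<^sup>L \<nu> f\<bar> |f. \<forall>x y. \<bar>f x - f y\<bar> \<le> d x y}"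
proof -
  have "f \<in> C_sa \<and> lipschitz_seminorm d f \<le> 1 \<longleftrightarrow> (\<forall>x y. \<bar>f x - f y\<bar> \<le> d x y)" for f
    using lipschitz_imp_continuous by (auto simp: C_sa_def lipschitz_seminorm_le_1_iff)
  then show ?thesis unfolding monge_kantorovich_def by simp
qed

lemma monge_kantorovich_commute: "monge_kantorovich d \<mu> \<nu> = monge_kantorovich d \<nu> \<mu>"
  unfolding monge_kantorovich_def by (simp add: abs_minus_commute)

lemma monge_kantorovich_least:
  assumes "\<And>f. (\<And>x y. \<bar>f x - f y\<bar> \<le> d x y) \<Longrightarrow> \<bar>integral\<^sup>L \<mu> f - integral\<^sup>L \<nu> f\<bar> \<le> r"
  shows "monge_kantorovich d \<mu> \<nu> \<le> r"
  unfolding monge_kantorovich_alt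
proof (rule cSup_least)
  \<comment> \<open>The zero function witnesses that the set of test values is inhabited.\<close>
  show "{\<bar>integral\<^sup>L \<mu> f - integral\<^sup>L \<nu> f\<bar> |f. \<forall>x y. \<bar>f x - f y\<bar> \<le> d x y} \<noteq> {}"
    by (auto intro!: exI[of _ "\<lambda>_. 0"])
qed (use assms in auto)

text \<open>
  The supremum is one of real numbers, so the bound is meaningful only because the test values are
  bounded: each of the two integrals is within the diameter of the value of \<open>f\<close> at a fixed point.
\<close>

lemma monge_kantorovich_upper:
  assumes "\<mu> \<in> states" "\<nu> \<in> states" and f: "\<And>x y. \<bar>f x - f y\<bar> \<le> d x y"
  shows "\<bar>integral\<^sup>L \<mu> f - integral\<^sup>L \<nu> f\<bar> \<le> monge_kantorovich d \<mu> \<nu>"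
  unfolding monge_kantorovich_alt
proof (rule cSup_upper)
  show "bdd_above {\<bar>integral\<^sup>L \<mu> f - integral\<^sup>L \<nu> f\<bar> |f. \<forall>x y. \<bar>f x - f y\<bar> \<le> d x y}"
  proof -
    obtain D where D: "\<And>x y. d x y < D" by (rule dist_bounded) blast
    fix p
    have near: "\<bar>integral\<^sup>L \<kappa> g - g p\<bar> \<le> D"
      if \<kappa>: "\<kappa> \<in> states" and g: "\<And>x y. \<bar>g x - g y\<bar> \<le> d x y" for \<kappa> and g :: "'a \<Rightarrow> real"
    proof -
      interpret prob_space \<kappa> using \<kappa> by (rule states_prob_space)
      have int: "integrable \<kappa> g"
        using \<kappa> by (intro continuous_integrable_state compact_UNIV lipschitz_imp_continuous g)
      have bnd: "g p - D \<le> g x \<and> g x \<le> g p + D" for x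
        using g[of x p] D[of x p] by auto
      have "integral\<^sup>L \<kappa> g \<le> g p + D" "g p - D \<le> integral\<^sup>L \<kappa> g"
        using bnd by (auto intro!: integral_le_const integral_ge_const int)
      then show ?thesis by auto
    qed
    show ?thesis
    proof (rule bdd_aboveI[of _ "2 * D"], clarify)
      fix g :: "'a \<Rightarrow> real" assume "\<forall>x y. \<bar>g x - g y\<bar> \<le> d x y"
      then show "\<bar>integral\<^sup>L \<mu> g - integral\<^sup>L \<nu> g\<bar> \<le> 2 * D"
        using near[of \<mu> g] near[of \<nu> g] assms by auto
    qed
  qed
qed (use f in auto)

definition dist_to :: "'a set \<Rightarrow> 'a \<Rightarrow> real" where
  "dist_to K x = (INF y\<in>K. d x y)"

context
  fixes K :: "'a set"
  assumes nonempty: "K \<noteq> {}"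
begin

lemma dist_to_le: "y \<in> K \<Longrightarrow> dist_to K x \<le> d x y"
  unfolding dist_to_def by (rule cINF_lower) (auto intro: bdd_belowI2[of _ 0])

lemma dist_to_nonneg: "0 \<le> dist_to K x"
  unfolding dist_to_def using nonempty by (intro cINF_greatest) auto

lemma dist_to_zero: "x \<in> K \<Longrightarrow> dist_to K x = 0"
  using dist_to_le[of x x] dist_to_nonneg[of x] by simp

lemma dist_to_less_imp: "dist_to K x < r \<Longrightarrow> \<exists>y\<in>K. d x y < r"
  unfolding dist_to_def using nonempty by (subst (asm) cINF_less_iff) (auto intro: bdd_belowI2[of _ 0])

lemma dist_to_lipschitz: "\<bar>dist_to K x - dist_to K y\<bar> \<le> d x y"
proof -
  have "dist_to K x - d x y \<le> dist_to K y" for x y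
    unfolding dist_to_def[of K y]
  proof (rule cINF_greatest[OF nonempty])
    show "dist_to K x - d x y \<le> d y z" if "z \<in> K" for z
      using dist_to_le[OF that, of x] triangle[of x y z] by auto
  qed
  from this[of x y] this[of y x] show ?thesis by (auto simp: commute[of y x])
qed

lemma dist_to_zero_iff:
  assumes "closed K"
  shows "dist_to K x = 0 \<longleftrightarrow> x \<in> K"
proof
  assume 0: "dist_to K x = 0"
  show "x \<in> K"
  proof (rule ccontr)
    assume "x \<notin> K"
    with assms obtain r where "r > 0" "\<forall>y. d x y < r \<longrightarrow> y \<notin> K"
      unfolding closed_def open_iff_ball by auto
    with dist_to_less_imp[of x r] 0 show False by auto
  qed
qed (rule dist_to_zero)

section \<open>Faces are weak* closed\<close>

text \<open>
  The integrand is nonnegative, so its integral vanishes only if it is zero almost everywhere.  The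
  right-hand side is a condition on a single continuous function, as weak* arguments require.
\<close>

lemma face_iff_integral_dist_to:
  assumes "closed K"
  shows "\<mu> \<in> face K \<longleftrightarrow> \<mu> \<in> states \<and> integral\<^sup>L \<mu> (dist_to K) = 0"
proof -
  have "integral\<^sup>L \<mu> (dist_to K) = 0 \<longleftrightarrow> (AE x in \<mu>. x \<in> K)" if "\<mu> \<in> states"
  proof -
    have "integrable \<mu> (dist_to K)"
      using that by (intro continuous_integrable_state compact_UNIV lipschitz_imp_continuous
          dist_to_lipschitz)
    then show ?thesis
      by (subst integral_nonneg_eq_0_iff_AE) (auto simp: dist_to_nonneg dist_to_zero_iff[OF assms])
  qed
  then show ?thesis by (auto simp: face_iff_AE[OF assms])
qed

end

lemma closedin_weak_star_face:
  fixes K :: "'a set"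
  assumes K: "closed K" "K \<noteq> {}"
  shows "closedin weak_star (face K)"
proof -
  \<comment> \<open>The weak* topology is generated by complex test functions.\<close>
  define g where "g x = complex_of_real (dist_to K x)" for x
  have g: "g \<in> C_complex"
    unfolding g_def C_complex_def
    using lipschitz_imp_continuous[OF dist_to_lipschitz[OF K(2)]] by (auto intro: continuous_intros)
  have "continuous_map weak_star (product_topology (\<lambda>_. euclidean) C_complex)
      (\<lambda>\<mu>. \<lambda>f\<in>C_complex. integral\<^sup>L \<mu> f)"
    unfolding weak_star_def
    using continuous_map_pullback[OF continuous_map_id] by (simp add: o_def)
  from continuous_map_compose[OF this continuous_map_product_projection[OF g]] g
  have "continuous_map weak_star euclidean (\<lambda>\<mu>. integral\<^sup>L \<mu> g)"
    by (simp add: o_def)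
  then have "closedin weak_star {\<mu> \<in> topspace weak_star. integral\<^sup>L \<mu> g \<in> {0}}"
    by (rule closedin_continuous_map_preimage) simp
  moreover have "topspace weak_star = (states :: 'a measure set)"
    unfolding weak_star_def topspace_pullback_topology by auto
  moreover have "integral\<^sup>L \<mu> g = complex_of_real (integral\<^sup>L \<mu> (dist_to K))" for \<mu>
    unfolding g_def by simp
  moreover have "face K = {\<mu> \<in> states. integral\<^sup>L \<mu> (dist_to K) = 0}"
    by (rule set_eqI) (simp add: face_iff_integral_dist_to[OF K(2,1)])
  ultimately show ?thesis by simp
qed

lemma face_in_closed_subsets:
  fixes K :: "'a set"
  assumes "closed K" "K \<noteq> {}"
  shows "face K \<in> closed_subsets weak_star"
  using closedin_weak_star_face[OF assms] dirac_in_face_iff[OF assms(1)] assms(2)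
  by (auto simp: closed_subsets_def)

section \<open>Comparing neighbourhoods of sets and of faces\<close>

lemma subset_Ball_on_if_face_subset:
  fixes K K' :: "'a set"
  assumes K: "closed K" and K': "closed K'" "K' \<noteq> {}"
    and sub: "face K \<subseteq> Ball_on states (monge_kantorovich d) (face K') r"
  shows "K \<subseteq> Ball_on UNIV d K' r"
proof
  fix x assume "x \<in> K"
  then have "return borel x \<in> face K" using K by (simp add: dirac_in_face_iff)
  with sub obtain \<nu> where \<nu>: "\<nu> \<in> face K'" "monge_kantorovich d \<nu> (return borel x) < r"
    and dirac: "return borel x \<in> states"
    by (auto simp: Ball_on_def)
  have lip: "\<bar>dist_to K' y - dist_to K' z\<bar> \<le> d y z" for y z
    by (rule dist_to_lipschitz[OF K'(2)])
  have "integral\<^sup>L (return borel x) (dist_to K') = dist_to K' x"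
    using borel_measurable_continuous_onI[OF lipschitz_imp_continuous[OF lip]]
    by (intro integral_return) auto
  moreover have "\<nu> \<in> states" "integral\<^sup>L \<nu> (dist_to K') = 0"
    using \<nu>(1) face_iff_integral_dist_to[OF K'(2,1)] by auto
  ultimately have "dist_to K' x \<le> monge_kantorovich d \<nu> (return borel x)"
    using monge_kantorovich_upper[of \<nu> "return borel x" "dist_to K'", OF _ dirac lip] by auto
  with \<nu>(2) have "dist_to K' x < r" by simp
  then have "\<exists>y\<in>K'. d x y < r" by (rule dist_to_less_imp[OF K'(2)])
  then show "x \<in> Ball_on UNIV d K' r" by (auto simp: Ball_on_def commute)
qed

text \<open>
  Send each point to some centre whose ball contains it.  Adding the centres one at a time, with the
  latest one taking precedence, keeps the map Borel.
\<close>

lemma finite_net_projection: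
  assumes "finite F" "F \<subseteq> L" "L \<noteq> {}"
  shows "\<exists>T. T \<in> borel_measurable borel \<and> finite (range T) \<and> range T \<subseteq> L \<and>
           (\<forall>x. (\<exists>p\<in>F. d p x < r) \<longrightarrow> d (T x) x < r)"
  using assms
proof (induction F)
  case empty
  then obtain q where "q \<in> L" by auto
  then show ?case by (intro exI[of _ "\<lambda>_. q"]) auto
next
  case (insert p F)
  then obtain T where T: "T \<in> borel_measurable borel" "finite (range T)" "range T \<subseteq> L"
    "\<And>x. \<exists>p\<in>F. d p x < r \<Longrightarrow> d (T x) x < r"
    by auto
  define T' where "T' x = (if d p x < r then p else T x)" for x
  have "{x. d p x < r} \<in> sets borel" using open_metric_ball by simp
  then have "T' \<in> borel_measurable borel"
    unfolding T'_def using T(1) by (intro measurable_If) auto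
  moreover have range: "range T' \<subseteq> insert p (range T)" by (auto simp: T'_def)
  then have "finite (range T')" using T(2) by (meson finite_insert finite_subset)
  moreover have "range T' \<subseteq> L" using range T(3) insert.prems by auto
  moreover have "\<forall>x. (\<exists>q\<in>insert p F. d q x < r) \<longrightarrow> d (T' x) x < r"
    using T(4) by (auto simp: T'_def)
  ultimately show ?case by blast
qed

text \<open>
  The strict inequality \<open>r < s\<close> absorbs the loss in the supremum over test functions, which turns the
  pointwise displacement bound \<open>< r\<close> into \<open>\<le> r\<close>.
\<close>

lemma face_subset_Ball_on:
  fixes K K' :: "'a set"
  assumes K: "closed K" and K': "closed K'" "K' \<noteq> {}"
    and sub: "K \<subseteq> Ball_on UNIV d K' r" and "r < s"
  shows "face K \<subseteq> Ball_on states (monge_kantorovich d) (face K') s"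
proof
  fix \<mu> assume "\<mu> \<in> face K"
  with K have \<mu>: "\<mu> \<in> states" and on_K: "AE x in \<mu>. x \<in> K" by (auto simp: face_iff_AE)
  interpret prob_space \<mu> using \<mu> by (rule states_prob_space)
  have "compact K" using compact_Int_closed[OF compact_UNIV K] by simp
  moreover have "K \<subseteq> (\<Union>p\<in>K'. {x. d p x < r})" using sub by (auto simp: Ball_on_def)
  ultimately obtain F where F: "F \<subseteq> K'" "finite F" "K \<subseteq> (\<Union>p\<in>F. {x. d p x < r})"
    using compactE_image[of K K' "\<lambda>p. {x. d p x < r}"] open_metric_ball by metis
  obtain T where T: "T \<in> borel_measurable borel" "finite (range T)" "range T \<subseteq> K'"
    and "\<And>x. \<exists>p\<in>F. d p x < r \<Longrightarrow> d (T x) x < r"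
    using finite_net_projection[OF F(2,1) K'(2)] by metis
  with F(3) have close: "d (T x) x < r" if "x \<in> K" for x
    using that by auto
  have T_meas: "T \<in> borel_measurable \<mu>"
    using T(1) by (simp cong: measurable_cong_sets add: states_sets[OF \<mu>])
  define \<nu> where "\<nu> = distr \<mu> borel T"
  have AE_\<nu>: "AE x in \<nu>. x \<in> C" if "closed C" "range T \<subseteq> C" for C
    unfolding \<nu>_def using that by (subst AE_distr_iff[OF T_meas]) auto
  have "\<nu> \<in> states"
  proof (rule finitely_supported_in_states[OF _ _ T(2)])
    show "prob_space \<nu>" unfolding \<nu>_def using T_meas by (rule prob_space_distr)
    show "AE x in \<nu>. x \<in> range T" using T(2) by (intro AE_\<nu> finite_imp_closed) auto
  qed (simp add: \<nu>_def)
  with K' T(3) have "\<nu> \<in> face K'" by (simp add: face_iff_AE AE_\<nu>)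
  have "monge_kantorovich d \<nu> \<mu> \<le> r"
  proof (rule monge_kantorovich_least)
    fix f :: "'a \<Rightarrow> real" assume f: "\<And>x y. \<bar>f x - f y\<bar> \<le> d x y"
    have cont: "continuous_on UNIV f" using f by (rule lipschitz_imp_continuous)
    note f_meas = borel_measurable_continuous_onI[OF cont]
    have int_f: "integrable \<mu> f"
      using cont \<mu> by (intro continuous_integrable_state compact_UNIV)
    have "integrable \<nu> f"
      using cont \<open>\<nu> \<in> states\<close> by (intro continuous_integrable_state compact_UNIV)
    then have int_fT: "integrable \<mu> (\<lambda>x. f (T x))"
      unfolding \<nu>_def using T_meas f_meas by (simp add: integrable_distr_eq)
    have "integral\<^sup>L \<nu> f - integral\<^sup>L \<mu> f = (\<integral>x. f (T x) - f x \<partial>\<mu>)"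
      unfolding \<nu>_def using T_meas f_meas int_f int_fT by (simp add: integral_distr)
    also have "\<bar>\<dots>\<bar> \<le> (\<integral>x. \<bar>f (T x) - f x\<bar> \<partial>\<mu>)" by (rule integral_abs_bound)
    also have "\<dots> \<le> r"
    proof (rule integral_le_const)
      show "AE x in \<mu>. \<bar>f (T x) - f x\<bar> \<le> r"
        using on_K
      proof eventually_elim
        case (elim x)
        with f[of "T x" x] close[of x] show ?case by simp
      qed
    qed (use int_f int_fT in auto)
    finally show "\<bar>integral\<^sup>L \<nu> f - integral\<^sup>L \<mu> f\<bar> \<le> r" .
  qed
  with \<open>r < s\<close> \<open>\<nu> \<in> face K'\<close> \<mu>
  show "\<mu> \<in> Ball_on states (monge_kantorovich d) (face K') s"
    by (auto simp: Ball_on_def intro!: bexI[of _ \<nu>])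
qed

theorem hausdorff_dist_face:
  fixes K K' :: "'a set"
  assumes K: "closed K" "K \<noteq> {}" and K': "closed K'" "K' \<noteq> {}"
  shows "hausdorff_dist states (monge_kantorovich d) (face K) (face K') = hausdorff_dist UNIV d K K'"
proof -
  define A where "A = {r. r > 0 \<and> K \<subseteq> Ball_on UNIV d K' r \<and> K' \<subseteq> Ball_on UNIV d K r}"
  define B where "B = {r. r > 0 \<and> face K \<subseteq> Ball_on states (monge_kantorovich d) (face K') r \<and>
                          face K' \<subseteq> Ball_on states (monge_kantorovich d) (face K) r}"
  have BA: "B \<subseteq> A"
    unfolding A_def B_def using subset_Ball_on_if_face_subset K K' by blast
  have AB: "s \<in> B" if "r \<in> A" "r < s" for r s
    using that face_subset_Ball_on[OF K(1) K' _ that(2)] face_subset_Ball_on[OF K'(1) K _ that(2)]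
    by (auto simp: A_def B_def)
  obtain D where "D > 0" "\<And>x y. d x y < D" by (rule dist_bounded) blast
  then have "D \<in> A" using K(2) K'(2) by (auto simp: A_def Ball_on_def)
  with AB[of D "D + 1"] have "A \<noteq> {}" "B \<noteq> {}" by auto
  have bdd: "bdd_below A" "bdd_below B"
    by (auto simp: A_def B_def intro!: bdd_belowI[of _ 0])
  have "Inf B \<le> r" if "r \<in> A" for r
    using AB[OF that] by (rule dense_ge[OF cInf_lower[OF _ bdd(2)]])
  then have "Inf B \<le> Inf A" using \<open>A \<noteq> {}\<close> by (intro cInf_greatest)
  moreover have "Inf A \<le> Inf B" using \<open>B \<noteq> {}\<close> bdd(1) BA by (rule cInf_superset_mono)
  ultimately show ?thesis by (simp add: hausdorff_dist_def A_def B_def)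
qed

end

lemma inj_on_face: "inj_on face {K :: 'a::t2_space set. closed K}"
proof (rule inj_onI, rule set_eqI)
  fix K K' :: "'a set" and x
  assume "K \<in> {K. closed K}" "K' \<in> {K. closed K}" "face K = face K'"
  then show "x \<in> K \<longleftrightarrow> x \<in> K'"
    using dirac_in_face_iff[of K x] dirac_in_face_iff[of K' x] by simp
qed

theorem proposition2:
  fixes d :: "'a::t2_space \<Rightarrow> 'a \<Rightarrow> real"
  assumes "compact (UNIV :: 'a set)"
    and "compatible_metric d"
  shows "face ` closed_subsets (euclidean :: 'a topology) \<subseteq> closed_subsets weak_star \<and>
    inj_on face (closed_subsets (euclidean :: 'a topology)) \<and>
    (\<forall>K\<in>closed_subsets (euclidean :: 'a topology). \<forall>K'\<in>closed_subsets euclidean.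
       hausdorff_dist states (monge_kantorovich d) (face K) (face K') = hausdorff_dist UNIV d K K')"
proof -
  interpret compact_metrized d using assms by unfold_locales
  have "closed_subsets (euclidean :: 'a topology) = {K. closed K \<and> K \<noteq> {}}"
    by (simp add: closed_subsets_def)
  then show ?thesis
    using face_in_closed_subsets hausdorff_dist_face
    by (auto intro: inj_on_subset[OF inj_on_face])
qed

end
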